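(* Let $G_1$ and $G_2$ be looped simple graphs. If there is a matroid isomorphism between $M(IAS(G_1))$ and $M(IAS(G_2))$, then there is a compatible isomorphism between them.
   Context: A looped simple graph is a finite graph in which each vertex may carry at most one loop and distinct non-loop edges join distinct pairs of vertices. For a looped simple graph $G$, $A(G)$ is its adjacency matrix over $GF(2)$: a diagonal entry is $1$ iff the vertex is looped, an off-diagonal entry is $1$ iff the vertices are adjacent. $IAS(G)$ is the $|V(G)|\times 3|V(G)|$ matrix $(I\mid A(G)\mid I+A(G))$ over $GF(2)$, and $M(IAS(G))$ is the binary matroid it represents (a set of columns is dependent iff linearly dependent). Its ground set $W(G)$ consists of the columns; for $v\in V(G)$, $v_\phi$, $v_\chi$, $v_\psi$ denote the columns corresponding to $v$ in $I$, $A(G)$, $I+A(G)$ respectively. The canonical partition of $W(G)$ is $\{\{v_\phi,v_\chi,v_\psi\}: v\in V(G)\}$. Let $S_3$ be the group of permutations of the symbols $\phi,\chi,\psi$. An isomorphism $\beta:M(IAS(G_1))\to M(IAS(G_2))$ is compatible if it maps each cell of the canonical partition of $W(G_1)$ onto a cell of the canonical partition of $W(G_2)$; it then induces a bijection $\beta:V(G_1)\to V(G_2)$ and a function $f_\beta:V(G_1)\to S_3$ with $\beta(v_\iota)=\beta(v)_{f_\beta(v)(\iota)}$ for all $v$ and $\iota\in\{\phi,\chi,\psi\}$; $\beta$ is said to be determined by $f_\beta$. *)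

theory Defs
  imports Main "HOL-Library.Z2"
begin

text \<open>A loop at \<open>v\<close> is the edge \<open>{v}\<close>; a non-loop edge joining \<open>u\<close> and \<open>v\<close> is \<open>{u, v}\<close>.
  As the edges form a set, there are no parallel edges and no parallel loops.\<close>

record 'v lgraph =
  verts :: "'v set"
  edges :: "'v set set"

definition looped_simple_graph :: "'v lgraph \<Rightarrow> bool" where
  "looped_simple_graph G \<longleftrightarrow>
     finite (verts G) \<and> (\<forall>e \<in> edges G. e \<subseteq> verts G \<and> (card e = 1 \<or> card e = 2))"

text \<open>Matrices over \<open>GF(2)\<close> are functions of a row index and a column index into the
  two-element field \<^typ>\<open>bit\<close>. On the diagonal \<open>{u, v}\<close> is the singleton \<open>{v}\<close>,
  so the entry there is \<open>1\<close> iff \<open>v\<close> is looped.\<close>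

definition adjacency_matrix :: "'v lgraph \<Rightarrow> 'v \<Rightarrow> 'v \<Rightarrow> bit" where
  "adjacency_matrix G u v = (if {u, v} \<in> edges G then 1 else 0)"

definition identity_matrix :: "'v \<Rightarrow> 'v \<Rightarrow> bit" where
  "identity_matrix u v = (if u = v then 1 else 0)"

datatype symb = Phi | Chi | Psi

text \<open>The columns of \<open>(I | A(G) | I + A(G))\<close> are indexed by pairs of a vertex and a symbol;
  the rows are indexed by the vertices.\<close>

fun IAS :: "'v lgraph \<Rightarrow> 'v \<Rightarrow> 'v \<times> symb \<Rightarrow> bit" where
  "IAS G u (v, Phi) = identity_matrix u v"
| "IAS G u (v, Chi) = adjacency_matrix G u v"
| "IAS G u (v, Psi) = identity_matrix u v + adjacency_matrix G u v"

definition W :: "'v lgraph \<Rightarrow> ('v \<times> symb) set" where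
  "W G = verts G \<times> UNIV"

text \<open>Linear dependence of the family of columns labelled by the finite set \<open>S\<close>, with rows
  indexed by \<open>R\<close>. Columns with different labels are different elements even if they
  are equal as vectors, in which case they are dependent.\<close>

definition columns_dependent ::
    "'r set \<Rightarrow> ('r \<Rightarrow> 'e \<Rightarrow> 'k::field) \<Rightarrow> 'e set \<Rightarrow> bool" where
  "columns_dependent R A S \<longleftrightarrow>
     (\<exists>c. (\<exists>w\<in>S. c w \<noteq> 0) \<and> (\<forall>u\<in>R. (\<Sum>w\<in>S. c w * A u w) = 0))"

record 'e matroid =
  ground :: "'e set"
  indep_sets :: "'e set set"

definition column_matroid ::
    "'r set \<Rightarrow> 'e set \<Rightarrow> ('r \<Rightarrow> 'e \<Rightarrow> 'k::field) \<Rightarrow> 'e matroid" where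
  "column_matroid R E A =
     \<lparr> ground = E, indep_sets = {S. S \<subseteq> E \<and> \<not> columns_dependent R A S} \<rparr>"

definition M_IAS :: "'v lgraph \<Rightarrow> ('v \<times> symb) matroid" where
  "M_IAS G = column_matroid (verts G) (W G) (IAS G)"

definition matroid_isomorphism ::
    "'e matroid \<Rightarrow> 'f matroid \<Rightarrow> ('e \<Rightarrow> 'f) \<Rightarrow> bool" where
  "matroid_isomorphism M N \<beta> \<longleftrightarrow>
     bij_betw \<beta> (ground M) (ground N) \<and>
     (\<forall>S. S \<subseteq> ground M \<longrightarrow> (S \<in> indep_sets M \<longleftrightarrow> \<beta> ` S \<in> indep_sets N))"

definition canonical_partition :: "'v lgraph \<Rightarrow> ('v \<times> symb) set set" where
  "canonical_partition G = (\<lambda>v. {(v, Phi), (v, Chi), (v, Psi)}) ` verts G"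

definition compatible ::
    "'v lgraph \<Rightarrow> 'w lgraph \<Rightarrow> ('v \<times> symb \<Rightarrow> 'w \<times> symb) \<Rightarrow> bool" where
  "compatible G H \<beta> \<longleftrightarrow> (\<forall>C \<in> canonical_partition G. \<beta> ` C \<in> canonical_partition H)"

end

theory Submission
  imports Defs "HOL-Library.Disjoint_Sets" "HOL-Combinatorics.Transposition"
begin

text \<open>A matroid isomorphism between binary matroids is a bijection preserving the cycles, that is, the
  sets of columns with sum zero. Transporting the canonical partition of one graph to the other
  matroid thus yields two partitions \<open>P\<close>, \<open>P'\<close> of one ground set into zero-sum triples, and it is enough
  to find an automorphism mapping \<open>P'\<close> to \<open>P\<close>. Symmetry of the adjacency matrix makes the cells of either
  partition an orthonormal basis of the same quotient space over \<open>GF(2)\<close>, so the matrix of intersection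
  parities is orthogonal. If two cells meet in exactly two elements, the remaining two elements
  are parallel and are transposed. Otherwise a cell of \<open>P\<close> outside \<open>P'\<close> meets three cells of \<open>P'\<close> once
  each, and orthogonality completes it to a block of four cells of \<open>P\<close> and four of \<open>P'\<close> on the same
  twelve elements, each cell missing exactly one of the other four. Reflecting this array is an
  automorphism, because it changes a cycle that is a cocycle by an even subgraph of \<open>K\<^sub>4\<close>, and the four
  triangles correspond to cycles. Either step increases the number of common cells.\<close>

section \<open>Reflection of a twelve-element array\<close>

lemma even_card_Int_triple:
  assumes "distinct [a, b, c]"
  shows "even (card (L \<inter> {a, b, c})) \<longleftrightarrow> ((a \<in> L \<longleftrightarrow> b \<in> L) \<longleftrightarrow> c \<notin> L)"
  using assms by (cases "a \<in> L"; cases "b \<in> L"; cases "c \<in> L") auto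

text \<open>Twelve elements are arranged in the array
  \<open>a  b  c  -\<close> / \<open>a2 b2 -  x\<close> / \<open>a3 -  c2 y\<close> / \<open>-  b3 c3 z\<close>.
  Reflecting it in the empty antidiagonal exchanges its rows with its columns.\<close>

definition array_swap ::
    "'e \<Rightarrow> 'e \<Rightarrow> 'e \<Rightarrow> 'e \<Rightarrow> 'e \<Rightarrow> 'e \<Rightarrow> 'e \<Rightarrow> 'e \<Rightarrow> 'e \<Rightarrow> 'e \<Rightarrow> 'e \<Rightarrow> 'e \<Rightarrow> 'e \<Rightarrow> 'e" where
  "array_swap a b c a2 a3 b2 b3 c2 c3 x y z = transpose a z \<circ> transpose b y \<circ> transpose c x \<circ>
     transpose a2 c3 \<circ> transpose b2 c2 \<circ> transpose a3 b3"

text \<open>Rows against columns: each of the four cells of \<open>P\<close> meets three of the four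
  cells of \<open>P'\<close> in one element and misses the fourth.\<close>

definition swappable_array :: "'e set set \<Rightarrow> 'e set set \<Rightarrow>
    'e \<Rightarrow> 'e \<Rightarrow> 'e \<Rightarrow> 'e \<Rightarrow> 'e \<Rightarrow> 'e \<Rightarrow> 'e \<Rightarrow> 'e \<Rightarrow> 'e \<Rightarrow> 'e \<Rightarrow> 'e \<Rightarrow> 'e \<Rightarrow> bool" where
  "swappable_array P P' a b c a2 a3 b2 b3 c2 c3 x y z \<longleftrightarrow>
     distinct [a, b, c, a2, a3, b2, b3, c2, c3, x, y, z] \<and>
     {a, b, c} \<in> P \<and> {a2, b2, x} \<in> P \<and> {a3, c2, y} \<in> P \<and> {b3, c3, z} \<in> P \<and>
     {a, a2, a3} \<in> P' \<and> {b, b2, b3} \<in> P' \<and> {c, c2, c3} \<in> P' \<and> {x, y, z} \<in> P'"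

context
  fixes a b c a2 a3 b2 b3 c2 c3 x y z :: 'e and \<sigma>
  assumes dist: "distinct [a, b, c, a2, a3, b2, b3, c2, c3, x, y, z]"
    and \<sigma>: "\<sigma> = array_swap a b c a2 a3 b2 b3 c2 c3 x y z"
begin

text \<open>Gives the inequalities of \<open>dist\<close> in the opposite orientation; evaluating
  the composed transpositions needs both.\<close>

lemma distinct_array_rev: "distinct [z, y, x, c3, c2, b3, b2, a3, a2, c, b, a]"
  using dist by auto

lemma array_swap_apply:
  shows "\<sigma> a = z" "\<sigma> z = a" "\<sigma> b = y" "\<sigma> y = b" "\<sigma> c = x" "\<sigma> x = c"
    "\<sigma> a2 = c3" "\<sigma> c3 = a2" "\<sigma> b2 = c2" "\<sigma> c2 = b2" "\<sigma> a3 = b3" "\<sigma> b3 = a3"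
  by (simp_all add: \<sigma> array_swap_def transpose_def dist[simplified] distinct_array_rev[simplified])

lemma array_swap_apply_other:
  "e \<notin> {a, b, c, a2, a3, b2, b3, c2, c3, x, y, z} \<Longrightarrow> \<sigma> e = e"
  by (simp add: \<sigma> array_swap_def)

lemma array_swap_array_swap: "\<sigma> (\<sigma> e) = e"
proof (cases "e \<in> {a, b, c, a2, a3, b2, b3, c2, c3, x, y, z}")
  case True
  then show ?thesis by (elim insertE emptyE; simp only: array_swap_apply)
next
  case False
  then show ?thesis using array_swap_apply_other by simp
qed

lemma bij_betw_array_swap:
  assumes "{a, b, c, a2, a3, b2, b3, c2, c3, x, y, z} \<subseteq> E"
  shows "bij_betw \<sigma> E E"
proof -
  have "\<sigma> e \<in> E" if "e \<in> E" for e
  proof (cases "e \<in> {a, b, c, a2, a3, b2, b3, c2, c3, x, y, z}")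
    case True
    then show ?thesis using assms by (elim insertE emptyE; simp add: array_swap_apply)
  next
    case False
    then show ?thesis using array_swap_apply_other that by simp
  qed
  then show ?thesis
    using array_swap_array_swap by (intro bij_betw_byWitness[where f' = \<sigma>]) auto
qed

text \<open>Number the rows from the top and the columns from the right. The reflection then
  transposes a matrix with empty diagonal, and the six exchanged pairs are the edges of K4. Row i
  and column i have the same parity, so the edges on which \<open>L\<close> is asymmetric form an
  even subgraph. It is a sum of triangles through vertex 1, and the edges 23, 24 and 34 decide which
  of them occur.\<close>

lemma image_array_swap:
  assumes rows: "even (card (L \<inter> {a, b, c}))" "even (card (L \<inter> {a2, b2, x}))"
      "even (card (L \<inter> {a3, c2, y}))" "even (card (L \<inter> {b3, c3, z}))"
    and cols: "even (card (L \<inter> {a, a2, a3}))" "even (card (L \<inter> {b, b2, b3}))"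
      "even (card (L \<inter> {c, c2, c3}))" "even (card (L \<inter> {x, y, z}))"
  shows "\<sigma> ` L = sym_diff (sym_diff (sym_diff L
      (if b2 \<in> L \<longleftrightarrow> c2 \<in> L then {} else {b, c, b2, x, c2, y}))
      (if a2 \<in> L \<longleftrightarrow> c3 \<in> L then {} else {a, c, a2, x, c3, z}))
      (if a3 \<in> L \<longleftrightarrow> b3 \<in> L then {} else {a, b, a3, y, b3, z})" (is "_ = ?R")
proof -
  have mem: "e \<in> \<sigma> ` L \<longleftrightarrow> \<sigma> e \<in> L" for e
    using array_swap_array_swap by (metis image_iff)
  \<comment> \<open>Evenness on a triple is a propositional condition on membership, so each of the
    twelve elements leaves a purely propositional goal.\<close>
  have par: "((a \<in> L \<longleftrightarrow> b \<in> L) \<longleftrightarrow> c \<notin> L)" "((a2 \<in> L \<longleftrightarrow> b2 \<in> L) \<longleftrightarrow> x \<notin> L)"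
    "((a3 \<in> L \<longleftrightarrow> c2 \<in> L) \<longleftrightarrow> y \<notin> L)" "((b3 \<in> L \<longleftrightarrow> c3 \<in> L) \<longleftrightarrow> z \<notin> L)"
    "((a \<in> L \<longleftrightarrow> a2 \<in> L) \<longleftrightarrow> a3 \<notin> L)" "((b \<in> L \<longleftrightarrow> b2 \<in> L) \<longleftrightarrow> b3 \<notin> L)"
    "((c \<in> L \<longleftrightarrow> c2 \<in> L) \<longleftrightarrow> c3 \<notin> L)" "((x \<in> L \<longleftrightarrow> y \<in> L) \<longleftrightarrow> z \<notin> L)"
    using rows cols dist by (simp_all add: even_card_Int_triple)
  show ?thesis
  proof (rule set_eqI)
    fix e
    show "e \<in> \<sigma> ` L \<longleftrightarrow> e \<in> ?R"
    proof (cases "e \<in> {a, b, c, a2, a3, b2, b3, c2, c3, x, y, z}")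
      case False
      then show ?thesis using array_swap_apply_other mem by auto
    next
      case True
      then show ?thesis
        unfolding mem
        by (elim insertE emptyE;
            simp add: array_swap_apply dist[simplified] distinct_array_rev[simplified];
            insert par; argo)
    qed
  qed
qed

end

section \<open>Parities, triples and images of partitions\<close>

lemma even_card_sym_diff_Int:
  assumes "finite A" "finite B"
  shows "even (card (sym_diff A B \<inter> C)) \<longleftrightarrow> (even (card (A \<inter> C)) \<longleftrightarrow> even (card (B \<inter> C)))"
proof -
  have "card (A \<inter> C) = card ((A - B) \<inter> C) + card (A \<inter> B \<inter> C)"
    using assms by (subst card_Un_disjoint[symmetric]) (auto intro: arg_cong[where f = card])
  moreover have "card (B \<inter> C) = card ((B - A) \<inter> C) + card (A \<inter> B \<inter> C)"
    using assms by (subst card_Un_disjoint[symmetric]) (auto intro: arg_cong[where f = card])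
  moreover have "card (sym_diff A B \<inter> C) = card ((A - B) \<inter> C) + card ((B - A) \<inter> C)"
    using assms by (subst card_Un_disjoint[symmetric]) (auto intro: arg_cong[where f = card])
  ultimately show ?thesis by simp presburger
qed

lemma card_3_obtain:
  assumes "card K = 3" "a \<in> K"
  obtains b c where "K = {a, b, c}" "distinct [a, b, c]"
proof -
  have "finite K" using assms(1) by (simp add: card_ge_0_finite)
  then have "card (K - {a}) = 2" using assms by simp
  then obtain b c where "K - {a} = {b, c}" "b \<noteq> c" by (auto simp: card_2_iff)
  then show thesis using that[of b c] assms(2) by auto
qed

lemma image_sym_diff:
  assumes "inj_on f E" "A \<subseteq> E" "B \<subseteq> E"
  shows "f ` sym_diff A B = sym_diff (f ` A) (f ` B)"
  using assms by (auto simp: inj_on_def)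

lemma partition_on_image:
  assumes "partition_on E P" "bij_betw f E F"
  shows "partition_on F ((`) f ` P)"
proof (rule partition_onI)
  show "\<Union> ((`) f ` P) = F"
    using assms by (auto simp: partition_on_def bij_betw_def)
  show "disjnt p q" if "p \<in> (`) f ` P" "q \<in> (`) f ` P" "p \<noteq> q" for p q
  proof -
    from that obtain K R where *: "K \<in> P" "R \<in> P" "p = f ` K" "q = f ` R" "K \<noteq> R"
      by blast
    then have "K \<inter> R = {}" "K \<subseteq> E" "R \<subseteq> E"
      using assms(1) by (auto simp: partition_on_def disjoint_def)
    moreover have "inj_on f E" using assms(2) by (simp add: bij_betw_def)
    ultimately have "f ` K \<inter> f ` R = f ` {}"
      by (metis inj_on_image_Int)
    then show ?thesis using * by (simp add: disjnt_def)
  qed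
  show "{} \<notin> (`) f ` P"
    using assms(1) by (auto simp: partition_on_def)
qed

section \<open>Cocycles, triangulations and isomorphisms of cycle spaces\<close>

text \<open>Over GF(2) the cocycle space of a matroid is the orthogonal complement of its cycle
  space with respect to intersection parity.\<close>

definition cocycle :: "'e set set \<Rightarrow> 'e set \<Rightarrow> bool" where
  "cocycle \<C> D \<longleftrightarrow> (\<forall>C\<in>\<C>. even (card (D \<inter> C)))"

text \<open>The last condition says that, for the form given by intersection parity, the cells are
  an orthonormal basis of the cycles modulo those cycles that are cocycles.\<close>

definition triangulation :: "'e set \<Rightarrow> 'e set set \<Rightarrow> 'e set set \<Rightarrow> bool" where
  "triangulation E \<C> P \<longleftrightarrow> partition_on E P \<and> P \<subseteq> \<C> \<and> (\<forall>K\<in>P. card K = 3) \<and>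
     (\<forall>D\<in>\<C>. (\<forall>K\<in>P. even (card (D \<inter> K))) \<longrightarrow> cocycle \<C> D)"

text \<open>Isomorphism in terms of cycles rather than independent sets, since cycles can be added.
  For binary column matroids the two notions agree by
  \<open>matroid_isomorphism_column_matroid_iff\<close>.\<close>

definition cycle_iso :: "'e set \<Rightarrow> 'e set set \<Rightarrow> 'f set \<Rightarrow> 'f set set \<Rightarrow> ('e \<Rightarrow> 'f) \<Rightarrow> bool" where
  "cycle_iso E \<C> F \<D> \<beta> \<longleftrightarrow> bij_betw \<beta> E F \<and> (\<forall>S\<subseteq>E. S \<in> \<C> \<longleftrightarrow> \<beta> ` S \<in> \<D>)"

lemma cycle_iso_comp:
  assumes "cycle_iso E \<C> F \<D> \<alpha>" "cycle_iso F \<D> H \<H> \<beta>"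
  shows "cycle_iso E \<C> H \<H> (\<beta> \<circ> \<alpha>)"
  unfolding cycle_iso_def
proof (intro conjI allI impI)
  show "bij_betw (\<beta> \<circ> \<alpha>) E H"
    using assms by (auto simp: cycle_iso_def intro: bij_betw_trans)
  fix S assume S: "S \<subseteq> E"
  then have "\<alpha> ` S \<subseteq> F" using assms(1) by (auto simp: cycle_iso_def bij_betw_def)
  then show "S \<in> \<C> \<longleftrightarrow> (\<beta> \<circ> \<alpha>) ` S \<in> \<H>"
    using assms S unfolding cycle_iso_def image_comp[symmetric] by blast
qed

text \<open>Serves to carry the canonical partition of one graph into the other matroid. A bijection
  preserves the sizes of intersections, and every cycle of the target is the image of a cycle, so
  the parity condition transfers.\<close>

lemma triangulation_image:
  assumes iso: "cycle_iso E \<C> F \<D> \<beta>" and "\<C> \<subseteq> Pow E" "\<D> \<subseteq> Pow F" and tri: "triangulation E \<C> P"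
  shows "triangulation F \<D> ((`) \<beta> ` P)"
proof -
  have bij: "bij_betw \<beta> E F" and inj: "inj_on \<beta> E"
    and cyc: "\<And>S. S \<subseteq> E \<Longrightarrow> S \<in> \<C> \<longleftrightarrow> \<beta> ` S \<in> \<D>"
    using iso by (auto simp: cycle_iso_def bij_betw_def)
  have sub: "K \<subseteq> E" if "K \<in> P" for K
    using tri that assms(2) by (auto simp: triangulation_def)
  have card_Int: "card (\<beta> ` A \<inter> \<beta> ` B) = card (A \<inter> B)" if "A \<subseteq> E" "B \<subseteq> E" for A B
  proof -
    have "card (\<beta> ` (A \<inter> B)) = card (A \<inter> B)"
      using inj that by (intro card_image inj_on_subset[OF inj]) auto
    then show ?thesis by (simp add: inj_on_image_Int[OF inj that])
  qed
  have pre: "\<exists>D'\<in>\<C>. D' \<subseteq> E \<and> D = \<beta> ` D'" if "D \<in> \<D>" for D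
  proof -
    have "D \<subseteq> \<beta> ` E" using that assms(3) bij by (auto simp: bij_betw_def)
    then obtain D' where "D' \<subseteq> E" "D = \<beta> ` D'" by (auto simp: subset_image_iff)
    then show ?thesis using cyc that by blast
  qed
  show ?thesis
    unfolding triangulation_def
  proof (intro conjI ballI impI)
    show "partition_on F ((`) \<beta> ` P)"
      using tri partition_on_image[OF _ bij] by (simp add: triangulation_def)
    show "(`) \<beta> ` P \<subseteq> \<D>"
    proof
      fix K assume "K \<in> (`) \<beta> ` P"
      then obtain R where R: "R \<in> P" "K = \<beta> ` R" by blast
      then have "R \<in> \<C>" using tri by (auto simp: triangulation_def)
      then show "K \<in> \<D>" using cyc[OF sub[OF R(1)]] R(2) by simp
    qed
    show "card K = 3" if "K \<in> (`) \<beta> ` P" for K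
    proof -
      from that obtain R where R: "R \<in> P" "K = \<beta> ` R" by blast
      then show ?thesis
        using tri card_image[OF inj_on_subset[OF inj sub[OF R(1)]]] by (simp add: triangulation_def)
    qed
    show "cocycle \<D> D" if D: "D \<in> \<D>" "\<forall>K\<in>(`) \<beta> ` P. even (card (D \<inter> K))" for D
    proof -
      obtain D' where D': "D' \<in> \<C>" "D' \<subseteq> E" "D = \<beta> ` D'" using pre D by blast
      have "even (card (D' \<inter> K))" if "K \<in> P" for K
        using D(2) D'(2,3) card_Int[OF D'(2) sub[OF that]] that by auto
      then have co: "cocycle \<C> D'"
        using tri D'(1) unfolding triangulation_def by blast
      show ?thesis
        unfolding cocycle_def
      proof
        fix C assume "C \<in> \<D>"
        then obtain C' where C': "C' \<in> \<C>" "C' \<subseteq> E" "C = \<beta> ` C'" using pre by blast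
        then show "even (card (D \<inter> C))"
          using co D'(2,3) card_Int by (simp add: cocycle_def)
      qed
    qed
  qed
qed

section \<open>Binary cycle spaces and their automorphisms\<close>

text \<open>A subspace of the power set of \<open>E\<close> as a vector space over GF(2). Its
  minimal nonempty members are the circuits of a binary matroid.\<close>

locale binary_cycle_space =
  fixes E :: "'e set" and \<C> :: "'e set set"
  assumes finite_ground: "finite E"
    and cycles_subset: "\<C> \<subseteq> Pow E"
    and empty_cycle: "{} \<in> \<C>"
    and sym_diff_cycle: "\<lbrakk>A \<in> \<C>; B \<in> \<C>\<rbrakk> \<Longrightarrow> sym_diff A B \<in> \<C>"
begin

lemma cycle_subset: "C \<in> \<C> \<Longrightarrow> C \<subseteq> E"
  using cycles_subset by auto

lemma finite_cycle: "C \<in> \<C> \<Longrightarrow> finite C"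
  using cycle_subset finite_ground finite_subset by metis

lemma triangulationD:
  assumes "triangulation E \<C> P"
  shows "K \<in> P \<Longrightarrow> K \<in> \<C>" "K \<in> P \<Longrightarrow> card K = 3" "finite P"
    "\<lbrakk>K \<in> P; R \<in> P; e \<in> K; e \<in> R\<rbrakk> \<Longrightarrow> K = R" "e \<in> E \<Longrightarrow> \<exists>K\<in>P. e \<in> K"
    "\<lbrakk>D \<in> \<C>; \<And>K. K \<in> P \<Longrightarrow> even (card (D \<inter> K))\<rbrakk> \<Longrightarrow> cocycle \<C> D"
proof -
  have part: "partition_on E P" and "P \<subseteq> \<C>" "\<forall>K\<in>P. card K = 3"
    "\<forall>D\<in>\<C>. (\<forall>K\<in>P. even (card (D \<inter> K))) \<longrightarrow> cocycle \<C> D"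
    using assms by (simp_all add: triangulation_def)
  then show "K \<in> P \<Longrightarrow> K \<in> \<C>" "K \<in> P \<Longrightarrow> card K = 3"
    "\<lbrakk>D \<in> \<C>; \<And>K. K \<in> P \<Longrightarrow> even (card (D \<inter> K))\<rbrakk> \<Longrightarrow> cocycle \<C> D"
    by auto
  show "finite P" using finite_elements[OF finite_ground part] .
  show "\<lbrakk>K \<in> P; R \<in> P; e \<in> K; e \<in> R\<rbrakk> \<Longrightarrow> K = R"
    using partition_onD2[OF part] by (auto simp: disjoint_def)
  show "e \<in> E \<Longrightarrow> \<exists>K\<in>P. e \<in> K"
    using partition_onD1[OF part] by blast
qed

text \<open>One direction suffices: there are finitely many cycles, so an injective map of them into
  themselves is onto.\<close>

lemma cycle_isoI:
  assumes bij: "bij_betw \<sigma> E E" and pres: "\<And>C. C \<in> \<C> \<Longrightarrow> \<sigma> ` C \<in> \<C>"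
  shows "cycle_iso E \<C> E \<C> \<sigma>"
proof -
  have inj: "inj_on ((`) \<sigma>) (Pow E)"
    using bij by (auto simp: bij_betw_def intro: inj_on_image_Pow)
  have im: "(`) \<sigma> ` \<C> = \<C>"
    using finite_subset[OF cycles_subset] finite_ground pres inj_on_subset[OF inj cycles_subset]
    by (intro endo_inj_surj) auto
  have "S \<in> \<C>" if "S \<subseteq> E" "\<sigma> ` S \<in> \<C>" for S
  proof -
    have "\<sigma> ` S \<in> (`) \<sigma> ` \<C>" using that(2) by (simp add: im)
    then obtain C where "C \<in> \<C>" "\<sigma> ` S = \<sigma> ` C" by (rule imageE)
    then show ?thesis
      using inj_onD[OF inj, of S C] that(1) cycle_subset[of C] by simp
  qed
  with bij pres show ?thesis by (auto simp: cycle_iso_def)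
qed

text \<open>The cells and the cycles that are cocycles span the cycle space.\<close>

lemma triangulation_cycle_isoI:
  assumes tri: "triangulation E \<C> P" and bij: "bij_betw \<sigma> E E"
    and cells: "\<And>K. K \<in> P \<Longrightarrow> \<sigma> ` K \<in> \<C>"
    and cocycles: "\<And>L. \<lbrakk>L \<in> \<C>; cocycle \<C> L\<rbrakk> \<Longrightarrow> \<sigma> ` L \<in> \<C>"
  shows "cycle_iso E \<C> E \<C> \<sigma>"
proof (rule cycle_isoI[OF bij])
  note T = triangulationD[OF tri]
  fix C assume "C \<in> \<C>"
  then show "\<sigma> ` C \<in> \<C>"
  proof (induction "card {K \<in> P. odd (card (C \<inter> K))}" arbitrary: C rule: less_induct)
    case less
    show ?case
    proof (cases "\<exists>K\<in>P. odd (card (C \<inter> K))")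
      case False
      then show ?thesis using T(6) cocycles less.prems by blast
    next
      case True
      then obtain K where K: "K \<in> P" "odd (card (C \<inter> K))" by blast
      \<comment> \<open>Adding \<open>K\<close> changes only the parity on \<open>K\<close> itself,
        because cells are disjoint and of odd size. Thus one odd cell fewer remains.\<close>
      let ?D = "sym_diff C K"
      have D: "?D \<in> \<C>" using sym_diff_cycle less.prems T(1) K(1) by blast
      have par: "even (card (?D \<inter> R)) \<longleftrightarrow> (even (card (C \<inter> R)) \<longleftrightarrow> even (card (K \<inter> R)))" for R
        using finite_cycle less.prems T(1) K(1) by (intro even_card_sym_diff_Int) auto
      have "even (card (?D \<inter> K))" using par[of K] T(2)[OF K(1)] K(2) by simp
      moreover have "even (card (?D \<inter> R)) \<longleftrightarrow> even (card (C \<inter> R))" if "R \<in> P" "R \<noteq> K" for R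
      proof -
        have "K \<inter> R = {}" using T(4) K(1) that by blast
        then show ?thesis using par[of R] by simp
      qed
      ultimately have "{R \<in> P. odd (card (?D \<inter> R))} \<subset> {R \<in> P. odd (card (C \<inter> R))}"
        using K by blast
      then have "\<sigma> ` ?D \<in> \<C>"
        using T(3) D by (intro less.hyps psubset_card_mono) auto
      moreover have "\<sigma> ` C = sym_diff (\<sigma> ` ?D) (\<sigma> ` K)"
      proof -
        have "C = sym_diff ?D K" by auto
        then have "\<sigma> ` C = \<sigma> ` sym_diff ?D K" by simp
        also have "\<dots> = sym_diff (\<sigma> ` ?D) (\<sigma> ` K)"
          using bij cycle_subset[OF D] cycle_subset[OF T(1)[OF K(1)]]
          by (intro image_sym_diff) (auto simp: bij_betw_def)
        finally show ?thesis .
      qed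
      ultimately show ?thesis using sym_diff_cycle cells[OF K(1)] by simp
    qed
  qed
qed

text \<open>The transposition either fixes a cycle or adds the cycle \<open>{a, d}\<close> to
  it.\<close>

lemma transpose_parallel_cycle_iso:
  assumes "{a, d} \<in> \<C>" "a \<noteq> d"
  shows "cycle_iso E \<C> E \<C> (transpose a d)"
proof (rule cycle_isoI)
  have "a \<in> E" "d \<in> E" using cycle_subset assms(1) by auto
  then show "bij_betw (transpose a d) E E" by (auto simp: bij_betw_transpose_iff)
  fix C assume C: "C \<in> \<C>"
  have "transpose a d ` C = (if a \<in> C \<longleftrightarrow> d \<in> C then C else sym_diff C {a, d})"
    using assms(2) by (auto simp: in_transpose_image_iff transpose_def)
  then show "transpose a d ` C \<in> \<C>" using sym_diff_cycle[OF C assms(1)] C by simp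
qed

end

section \<open>Automorphisms that gain a common cell\<close>

lemma even_card_Int_obtain:
  assumes "even (card (D \<inter> R))" "e \<in> D" "e \<in> R"
  obtains f where "f \<in> D" "f \<in> R" "f \<noteq> e"
proof -
  have "D \<inter> R \<noteq> {e}" using assms(1) by force
  with assms that show thesis by blast
qed

text \<open>The progress measure: common cells survive because they are fixed, and the image of
  \<open>Q\<close> is a further one.\<close>

lemma card_common_cells_less:
  assumes "finite P" "\<And>K. \<lbrakk>K \<in> P; K \<in> P'\<rbrakk> \<Longrightarrow> \<sigma> ` K = K" "Q \<in> P'" "\<sigma> ` Q \<in> P" "\<sigma> ` Q \<notin> P'"
  shows "card (P \<inter> P') < card (P \<inter> (`) \<sigma> ` P')"
proof (rule psubset_card_mono)
  show "finite (P \<inter> (`) \<sigma> ` P')" using assms(1) by simp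
  have "P \<inter> P' \<subseteq> P \<inter> (`) \<sigma> ` P'"
    using assms(2) by (metis IntD1 IntD2 IntI image_eqI subsetI)
  then show "P \<inter> P' \<subset> P \<inter> (`) \<sigma> ` P'"
    using assms(3-5) by blast
qed

context binary_cycle_space
begin

text \<open>The hexad is the sum of the crossing cycle \<open>{a, b, c}\<close> and the three cells
  that it crosses. It meets each of these in two elements and all other cells in none, so the
  triangulation property makes it a cocycle. Cells of any other triangulation must then meet it
  evenly.\<close>

lemma crossing_triple:
  assumes tri: "triangulation E \<C> P"
    and cells: "{a, a2, a3} \<in> P" "{b, b2, b3} \<in> P" "{c, c2, c3} \<in> P" and cyc: "{a, b, c} \<in> \<C>"
    and dist: "distinct [a, b, c, a2, a3, b2, b3, c2, c3]"
  shows "{a2, a3, b2, b3, c2, c3} \<in> \<C>" "cocycle \<C> {a2, a3, b2, b3, c2, c3}"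
proof -
  note T = triangulationD[OF tri]
  let ?D = "{a2, a3, b2, b3, c2, c3}"
  have "?D = sym_diff (sym_diff (sym_diff {a, b, c} {a, a2, a3}) {b, b2, b3}) {c, c2, c3}"
    using dist by auto
  then show D: "?D \<in> \<C>"
    using sym_diff_cycle cyc T(1) cells by (simp only:)
  show "cocycle \<C> ?D"
  proof (rule T(6)[OF D])
    fix R assume R: "R \<in> P"
    consider "R = {a, a2, a3}" | "R = {b, b2, b3}" | "R = {c, c2, c3}" | "?D \<inter> R = {}"
      using T(4)[OF R] cells by blast
    then show "even (card (?D \<inter> R))"
    proof cases
      case 1
      then have "?D \<inter> R = {a2, a3}" using dist by auto
      then show ?thesis using dist by simp
    next
      case 2
      then have "?D \<inter> R = {b2, b3}" using dist by auto
      then show ?thesis using dist by simp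
    next
      case 3
      then have "?D \<inter> R = {c2, c3}" using dist by auto
      then show ?thesis using dist by simp
    next
      case 4
      then show ?thesis by simp
    qed
  qed
qed

text \<open>The sum of the two cells is a two-element cycle. Transposing its elements maps
  \<open>K'\<close> to \<open>K\<close>, and a common cell contains neither of them, being disjoint
  from both \<open>K\<close> and \<open>K'\<close>.\<close>

lemma triangulation_step_parallel:
  assumes tri: "triangulation E \<C> P" and tri': "triangulation E \<C> P'"
    and K: "K \<in> P" "K' \<in> P'" "card (K \<inter> K') = 2"
  shows "\<exists>\<sigma>. cycle_iso E \<C> E \<C> \<sigma> \<and> card (P \<inter> P') < card (P \<inter> (`) \<sigma> ` P')"
proof -
  note T = triangulationD[OF tri] and T' = triangulationD[OF tri']
  have fin: "finite K" "finite K'" using T(1) T'(1) K finite_cycle by auto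
  have "card (K - K') = 1" "card (K' - K) = 1"
    using T(2)[OF K(1)] T'(2)[OF K(2)] K(3) fin card_Diff_subset_Int[of K K']
      card_Diff_subset_Int[of K' K] by (auto simp: Int_commute)
  then obtain a d where ad: "K - K' = {a}" "K' - K = {d}" by (auto simp: card_1_singleton_iff)
  obtain b where b: "b \<in> K" "b \<in> K'" 
  proof -
    have "K \<inter> K' \<noteq> {}" using K(3) by force
    with that show thesis by blast
  qed
  have "a \<noteq> d" using ad by auto
  have "sym_diff K K' = {a, d}" using ad by auto
  then have "{a, d} \<in> \<C>" using sym_diff_cycle[OF T(1)[OF K(1)] T'(1)[OF K(2)]] by simp
  then have iso: "cycle_iso E \<C> E \<C> (transpose a d)"
    using transpose_parallel_cycle_iso \<open>a \<noteq> d\<close> by blast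
  have K': "K \<notin> P'" "K' \<notin> P"
    using T(4)[of K K' b] T'(4)[of K K' b] K b ad by auto
  have "card (P \<inter> P') < card (P \<inter> (`) (transpose a d) ` P')"
  proof (rule card_common_cells_less[OF T(3)])
    show "transpose a d ` R = R" if "R \<in> P" "R \<in> P'" for R
    proof -
      have "a \<notin> R" "d \<notin> R"
        using T(4)[of R K a] T'(4)[of R K' d] K K' ad that by auto
      then show ?thesis by simp
    qed
    show "K' \<in> P'" by fact
    have "transpose a d ` K' = insert a (K' - {d})"
      using ad by (auto simp: in_transpose_image_iff transpose_def)
    also have "\<dots> = K" using ad by auto
    finally show "transpose a d ` K' \<in> P" "transpose a d ` K' \<notin> P'"
      using K K' by auto
  qed
  with iso show ?thesis by blast
qed

lemma triangulation_step_array: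
  assumes tri: "triangulation E \<C> P" and tri': "triangulation E \<C> P'"
    and arr: "swappable_array P P' a b c a2 a3 b2 b3 c2 c3 x y z"
  shows "\<exists>\<sigma>. cycle_iso E \<C> E \<C> \<sigma> \<and> card (P \<inter> P') < card (P \<inter> (`) \<sigma> ` P')"
proof -
  note T = triangulationD[OF tri] and T' = triangulationD[OF tri']
  define \<sigma> where "\<sigma> = array_swap a b c a2 a3 b2 b3 c2 c3 x y z"
  have dist: "distinct [a, b, c, a2, a3, b2, b3, c2, c3, x, y, z]"
    and rows: "{a, b, c} \<in> P" "{a2, b2, x} \<in> P" "{a3, c2, y} \<in> P" "{b3, c3, z} \<in> P"
    and cols: "{a, a2, a3} \<in> P'" "{b, b2, b3} \<in> P'" "{c, c2, c3} \<in> P'" "{x, y, z} \<in> P'"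
    using arr by (simp_all add: swappable_array_def)
  note vals = array_swap_apply[OF dist \<sigma>_def]
  have sub: "{a, b, c, a2, a3, b2, b3, c2, c3, x, y, z} \<subseteq> E"
    using cycle_subset[OF T(1)[OF rows(1)]] cycle_subset[OF T(1)[OF rows(2)]]
      cycle_subset[OF T(1)[OF rows(3)]] cycle_subset[OF T(1)[OF rows(4)]] by auto
  have fixed: "\<sigma> ` R = R" if "R \<in> P" "R \<notin> {{a, b, c}, {a2, b2, x}, {a3, c2, y}, {b3, c3, z}}" for R
  proof -
    have "e \<notin> {a, b, c, a2, a3, b2, b3, c2, c3, x, y, z}" if "e \<in> R" for e
      using T(4)[OF \<open>R \<in> P\<close> rows(1) that] T(4)[OF \<open>R \<in> P\<close> rows(2) that]
        T(4)[OF \<open>R \<in> P\<close> rows(3) that] T(4)[OF \<open>R \<in> P\<close> rows(4) that]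
        \<open>R \<notin> _\<close> by blast
    then show ?thesis
      using array_swap_apply_other[OF dist \<sigma>_def] by (simp add: image_def)
  qed
  have images: "\<sigma> ` {a, b, c} = {x, y, z}" "\<sigma> ` {a2, b2, x} = {c, c2, c3}"
    "\<sigma> ` {a3, c2, y} = {b, b2, b3}" "\<sigma> ` {b3, c3, z} = {a, a2, a3}" "\<sigma> ` {x, y, z} = {a, b, c}"
    by (auto simp: vals)
  \<comment> \<open>The three hexads of \<open>image_array_swap\<close> are cycles: they arise from
    the columns of \<open>a\<close>, \<open>b\<close> and \<open>c\<close>, each of which crosses
    three rows.\<close>
  have tri1: "{b, c, b2, x, c2, y} \<in> \<C>"
    using crossing_triple(1)[OF tri, of a b c a2 b2 x a3 c2 y] rows T'(1)[OF cols(1)] dist by auto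
  have tri2: "{a, c, a2, x, c3, z} \<in> \<C>"
    using crossing_triple(1)[OF tri, of b a c b2 a2 x b3 c3 z] rows T'(1)[OF cols(2)] dist
    by (auto simp: insert_commute)
  have tri3: "{a, b, a3, y, b3, z} \<in> \<C>"
    using crossing_triple(1)[OF tri, of c a b c2 a3 y c3 b3 z] rows T'(1)[OF cols(3)] dist
    by (auto simp: insert_commute)
  have "cycle_iso E \<C> E \<C> \<sigma>"
  proof (rule triangulation_cycle_isoI[OF tri bij_betw_array_swap[OF dist \<sigma>_def sub]])
    show "\<sigma> ` R \<in> \<C>" if "R \<in> P" for R
    proof (cases "R \<in> {{a, b, c}, {a2, b2, x}, {a3, c2, y}, {b3, c3, z}}")
      case True
      then show ?thesis using T'(1) cols by (elim insertE emptyE; simp only: images)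
    next
      case False
      then show ?thesis using fixed T(1) that by simp
    qed
    fix L assume L: "L \<in> \<C>" "cocycle \<C> L"
    \<comment> \<open>A cocycle meets every cell of both partitions evenly, so
      \<open>image_array_swap\<close> applies to \<open>L\<close>.\<close>
    have ev: "even (card (L \<inter> C))" if "C \<in> P \<union> P'" for C
      using L(2) that T(1) T'(1) by (auto simp: cocycle_def)
    from empty_cycle tri1 tri2 tri3 have
      t: "(if b2 \<in> L \<longleftrightarrow> c2 \<in> L then {} else {b, c, b2, x, c2, y}) \<in> \<C>"
      "(if a2 \<in> L \<longleftrightarrow> c3 \<in> L then {} else {a, c, a2, x, c3, z}) \<in> \<C>"
      "(if a3 \<in> L \<longleftrightarrow> b3 \<in> L then {} else {a, b, a3, y, b3, z}) \<in> \<C>"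
      by simp_all
    have "\<sigma> ` L = sym_diff (sym_diff (sym_diff L
        (if b2 \<in> L \<longleftrightarrow> c2 \<in> L then {} else {b, c, b2, x, c2, y}))
        (if a2 \<in> L \<longleftrightarrow> c3 \<in> L then {} else {a, c, a2, x, c3, z}))
        (if a3 \<in> L \<longleftrightarrow> b3 \<in> L then {} else {a, b, a3, y, b3, z})"
      using rows cols by (intro image_array_swap[OF dist \<sigma>_def] ev) simp_all
    then show "\<sigma> ` L \<in> \<C>"
      using sym_diff_cycle[OF sym_diff_cycle[OF sym_diff_cycle[OF L(1) t(1)] t(2)] t(3)]
      by (simp only:)
  qed
  moreover have "card (P \<inter> P') < card (P \<inter> (`) \<sigma> ` P')"
  proof (rule card_common_cells_less[OF T(3)])
    \<comment> \<open>Each row shares an element with a column but differs from it, so no row is in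
      \<open>P'\<close>. Common cells therefore avoid the array and are fixed, while the last column
      moves to the first row, a new common cell.\<close>
    have "{a, b, c} \<noteq> {a, a2, a3}" "{a2, b2, x} \<noteq> {a, a2, a3}" "{a3, c2, y} \<noteq> {a, a2, a3}"
      "{b3, c3, z} \<noteq> {b, b2, b3}" using dist by auto
    then have new: "{a, b, c} \<notin> P'" "{a2, b2, x} \<notin> P'" "{a3, c2, y} \<notin> P'" "{b3, c3, z} \<notin> P'"
      using T'(4)[OF _ cols(1), of "{a, b, c}" a] T'(4)[OF _ cols(1), of "{a2, b2, x}" a2]
        T'(4)[OF _ cols(1), of "{a3, c2, y}" a3] T'(4)[OF _ cols(2), of "{b3, c3, z}" b3]
      by simp_all blast+
    then show "\<sigma> ` R = R" if "R \<in> P" "R \<in> P'" for R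
      using fixed[OF that(1)] that(2) by blast
    show "{x, y, z} \<in> P'" by fact
    show "\<sigma> ` {x, y, z} \<in> P" "\<sigma> ` {x, y, z} \<notin> P'"
      unfolding images using rows new by simp_all
  qed
  ultimately show ?thesis by blast
qed

section \<open>Existence of a swappable array\<close>

text \<open>\<open>K\<close> becomes the first row, and the three cells of \<open>P'\<close> through
  it the first three columns. By parity, cells of \<open>P\<close> split the hexad below
  \<open>K\<close> into three pairs, each joining two different columns, which gives the other rows.
  Hexads built from the rows then force the last column.\<close>

lemma swappable_array_exists:
  assumes tri: "triangulation E \<C> P" and tri': "triangulation E \<C> P'"
    and single: "\<And>R C. \<lbrakk>R \<in> P; C \<in> P'\<rbrakk> \<Longrightarrow> card (R \<inter> C) \<noteq> 2"
    and K: "K \<in> P" "K \<notin> P'"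
  shows "\<exists>a b c a2 a3 b2 b3 c2 c3 x y z. swappable_array P P' a b c a2 a3 b2 b3 c2 c3 x y z"
proof -
  note T = triangulationD[OF tri] and T' = triangulationD[OF tri']
  \<comment> \<open>Two common elements force a third by \<open>single\<close>, and then the two
    triples coincide.\<close>
  have meet: "R = C" if "R \<in> P" "C \<in> P'" "e \<in> R" "f \<in> R" "e \<in> C" "f \<in> C" "e \<noteq> f" for R C e f
  proof -
    have fin: "finite R" "finite C" using T(1) T'(1) finite_cycle that by auto
    have "card {e, f} \<le> card (R \<inter> C)" using fin that by (intro card_mono) auto
    moreover have "card (R \<inter> C) \<le> 3" using T(2)[OF that(1)] fin by (metis card_mono inf_le1)
    ultimately have "card (R \<inter> C) = 3" using single[OF that(1,2)] that(7) by simp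
    then show ?thesis
      using card_subset_eq[of R "R \<inter> C"] card_subset_eq[of C "R \<inter> C"] T(2) T'(2) that fin by auto
  qed
  have cross: "e = f" if "R \<in> P" "C \<in> P'" "e \<in> R" "f \<in> R" "e \<in> C" "f \<in> C" "g \<in> C" "g \<notin> R" for R C e f g
    using meet that by blast
  obtain a0 where a0: "a0 \<in> K" using T(2)[OF K(1)] by force
  have KE: "K \<subseteq> E" using cycle_subset T(1) K(1) by blast
  have column: "\<exists>C u v. C \<in> P' \<and> C = {e, u, v} \<and> distinct [e, u, v] \<and> K \<inter> C = {e}" if e: "e \<in> K" for e
  proof -
    obtain C where C: "C \<in> P'" "e \<in> C" using T'(5) KE e by blast
    obtain u v where uv: "C = {e, u, v}" "distinct [e, u, v]"
      using card_3_obtain[OF T'(2)[OF C(1)] C(2)] by metis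
    have "K \<inter> C = {e}" using meet[OF K(1) C(1) e _ C(2)] e C K(2) by blast
    with C uv show ?thesis by blast
  qed
  obtain a b' c' where abc': "K = {a, b', c'}" "distinct [a, b', c']"
    using card_3_obtain[OF T(2)[OF K(1)] a0] by metis
  obtain A a2 a3 where A: "A \<in> P'" "A = {a, a2, a3}" "distinct [a, a2, a3]" "K \<inter> A = {a}"
    using column[of a] abc' by auto
  obtain B' b2' b3' where B': "B' \<in> P'" "B' = {b', b2', b3'}" "distinct [b', b2', b3']" "K \<inter> B' = {b'}"
    using column[of b'] abc' by auto
  obtain C' c2' c3' where C': "C' \<in> P'" "C' = {c', c2', c3'}" "distinct [c', c2', c3']" "K \<inter> C' = {c'}"
    using column[of c'] abc' by auto
  have disj': "A \<inter> B' = {}" "A \<inter> C' = {}" "B' \<inter> C' = {}"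
  proof -
    have "A \<noteq> B'" "A \<noteq> C'" "B' \<noteq> C'" using A(4) B'(4) C'(4) abc'(2) by auto
    then show "A \<inter> B' = {}" "A \<inter> C' = {}" "B' \<inter> C' = {}" using T'(4) A(1) B'(1) C'(1) by blast+
  qed
  have dist': "distinct [a, b', c', a2, a3, b2', b3', c2', c3']"
    using A(2,3) B'(2,3) C'(2,3) disj' by auto
  have cells': "{a, a2, a3} \<in> P'" "{b', b2', b3'} \<in> P'" "{c', c2', c3'} \<in> P'"
    using A(1,2) B'(1,2) C'(1,2) by simp_all
  \<comment> \<open>Here \<open>K\<close> is the crossing cycle and the columns are the cells
    crossed, so cells of \<open>P\<close> meet the remaining hexad evenly.\<close>
  have D': "cocycle \<C> {a2, a3, b2', b3', c2', c3'}"
    using crossing_triple(2)[OF tri' cells'] T(1)[OF K(1)] abc'(1) dist' by simp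
  obtain R where R: "R \<in> P" "a2 \<in> R"
    using T(5) cycle_subset T'(1)[OF cells'(1)] by (metis insert_subset)
  have RK: "e \<notin> R" if "e \<in> K" for e
  proof
    assume "e \<in> R"
    then have "R = K" using T(4)[OF R(1) K(1)] that by blast
    then have "a2 \<in> K \<inter> A" using R(2) A(2) by simp
    then show False using A(3,4) by simp
  qed
  have "even (card ({a2, a3, b2', b3', c2', c3'} \<inter> R))"
    using D' T(1)[OF R(1)] by (simp add: cocycle_def)
  then obtain f where f: "f \<in> {a2, a3, b2', b3', c2', c3'}" "f \<in> R" "f \<noteq> a2"
    using even_card_Int_obtain[OF _ _ R(2)] by blast
  \<comment> \<open>Otherwise \<open>R\<close> would share two elements with the column of
    \<open>a\<close>, hence equal it and contain \<open>a\<close>.\<close>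
  have "f \<noteq> a3"
    using cross[OF R(1) cells'(1), of f a2 a] f R(2) RK[of a] abc'(1) by auto
  with f have "f \<in> {b2', b3', c2', c3'}" by auto
  \<comment> \<open>By symmetry the second and third columns, and the two lower elements of a
    column, may be renamed so that \<open>f\<close> becomes \<open>b2\<close>.\<close>
  then have "\<exists>b c b2 b3 c2 c3. f = b2 \<and> K = {a, b, c} \<and> {b, b2, b3} \<in> P' \<and> {c, c2, c3} \<in> P' \<and>
      distinct [a, b, c, a2, a3, b2, b3, c2, c3]"
  proof (elim insertE emptyE)
    assume "f = b2'"
    then show ?thesis using abc'(1) cells' dist' by blast
  next
    assume "f = b3'"
    moreover have "{b', b3', b2'} \<in> P'" "distinct [a, b', c', a2, a3, b3', b2', c2', c3']"
      using cells' dist' by (auto simp: insert_commute)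
    ultimately show ?thesis using abc'(1) cells' by blast
  next
    assume "f = c2'"
    moreover have "K = {a, c', b'}" "distinct [a, c', b', a2, a3, c2', c3', b2', b3']"
      using abc' dist' by (auto simp: insert_commute)
    ultimately show ?thesis using cells' by blast
  next
    assume "f = c3'"
    moreover have "K = {a, c', b'}" "{c', c3', c2'} \<in> P'" "distinct [a, c', b', a2, a3, c3', c2', b2', b3']"
      using abc' cells' dist' by (auto simp: insert_commute)
    ultimately show ?thesis using cells' by blast
  qed
  then obtain b c b2 b3 c2' c3' where abc: "K = {a, b, c}" and B: "{b, b2, b3} \<in> P'" and b2: "b2 \<in> R"
    and C'': "{c, c2', c3'} \<in> P'" and dist'': "distinct [a, b, c, a2, a3, b2, b3, c2', c3']"
    using f(2) by metis
  have A': "{a, a2, a3} \<in> P'" by fact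
  have abcP: "{a, b, c} \<in> P" using abc K(1) by simp
  let ?D = "{a2, a3, b2, b3, c2', c3'}"
  have "cocycle \<C> ?D"
    using crossing_triple(2)[OF tri' A' B C'' _ dist''] T(1)[OF abcP] by simp
  then have ev: "even (card (?D \<inter> R))" if "R \<in> P" for R
    using T(1)[OF that] by (simp add: cocycle_def)
  have ex: "\<exists>f\<in>?D. f \<in> R \<and> f \<noteq> e" if "R \<in> P" "e \<in> R" "e \<in> ?D" for R e
    using even_card_Int_obtain[OF ev[OF that(1)] that(3) that(2)] by blast
  have ne: "a2 \<noteq> b2" using dist'' by simp
  obtain x where x: "R = {a2, b2, x}" "distinct [a2, b2, x]"
  proof -
    obtain u v where uv: "R = {a2, u, v}" "distinct [a2, u, v]"
      using card_3_obtain[OF T(2)[OF R(1)] R(2)] by metis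
    then consider "u = b2" | "v = b2" using b2 ne by auto
    then show thesis
      using that[of u] that[of v] uv by cases (auto simp: insert_commute)
  qed
  \<comment> \<open>Otherwise all three elements of \<open>R\<close> would lie in the hexad, against
    even parity. The same argument later excludes \<open>y\<close> and \<open>z\<close>.\<close>
  have xD: "x \<notin> ?D"
  proof
    assume "x \<in> ?D"
    then have "?D \<inter> R = R" using x by auto
    then show False using ev[OF R(1)] T(2)[OF R(1)] by simp
  qed
  have notK: "e \<notin> K" if "e \<in> ?D" for e using that dist'' abc by auto
  obtain S where S: "S \<in> P" "a3 \<in> S"
    using T(5) cycle_subset T'(1)[OF A'] by (metis insert_subset)
  have SK: "S \<inter> K = {}" using T(4)[OF S(1) K(1)] S(2) notK[of a3] by blast
  have RK': "R \<inter> K = {}" using RK by auto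
  have "a3 \<notin> R" using xD x dist'' by auto
  then have SR: "S \<inter> R = {}" using T(4)[OF S(1) R(1)] S(2) by blast
  obtain g where g: "g \<in> ?D" "g \<in> S" "g \<noteq> a3" using ex[OF S(1,2)] by auto
  have g': "g \<in> {b3, c2', c3'}" using g SR x(1) by auto
  obtain T0 where T0: "T0 \<in> P" "b3 \<in> T0"
    using T(5) cycle_subset T'(1)[OF B] by (metis insert_subset)
  have TK: "T0 \<inter> K = {}" using T(4)[OF T0(1) K(1)] T0(2) notK[of b3] by blast
  have "b3 \<notin> R" using xD x dist'' by auto
  then have TR: "T0 \<inter> R = {}" using T(4)[OF T0(1) R(1)] T0(2) by blast
  \<comment> \<open>If \<open>S\<close> joined \<open>a3\<close> to \<open>b3\<close>, then
    \<open>R\<close> and \<open>S\<close> would use up the hexad elements of the first two columns.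
    The cell through \<open>c2'\<close> could meet the hexad again only in \<open>c3'\<close>, in
    its own column, which \<open>cross\<close> forbids.\<close>
  have "g \<noteq> b3"
  proof
    assume "g = b3"
    have c2not: "c2' \<notin> S"
    proof
      assume "c2' \<in> S"
      then have "{a3, b3, c2'} \<subseteq> S" using S(2) g \<open>g = b3\<close> by auto
      moreover have "card {a3, b3, c2'} = 3" using dist'' by auto
      ultimately have "{a3, b3, c2'} = S"
        using card_subset_eq[of S "{a3, b3, c2'}"] T(2)[OF S(1)] T(1)[OF S(1)] finite_cycle by simp
      then have "?D \<inter> S = S" by auto
      then show False using ev[OF S(1)] T(2)[OF S(1)] by simp
    qed
    obtain U where U: "U \<in> P" "c2' \<in> U"
      using T(5) cycle_subset T'(1)[OF C''] by (metis insert_subset)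
    have "c2' \<notin> R" using xD x dist'' by auto
    then have UR: "U \<inter> R = {}" using T(4)[OF U(1) R(1)] U(2) by blast
    have US: "U \<inter> S = {}" using T(4)[OF U(1) S(1)] U(2) c2not by blast
    have UK: "U \<inter> K = {}" using T(4)[OF U(1) K(1)] U(2) notK[of c2'] by blast
    obtain h where h: "h \<in> ?D" "h \<in> U" "h \<noteq> c2'" using ex[OF U] by auto
    have "h = c3'" using h UR US x(1) S(2) g(2) \<open>g = b3\<close> by auto
    then show False
      using cross[OF U(1) C'', of c2' c3' c] h U UK abc by auto
  qed
  then have "\<exists>c2 c3. g = c2 \<and> {c, c2, c3} \<in> P' \<and> distinct [a, b, c, a2, a3, b2, b3, c2, c3] \<and>
      {c2, c3} = {c2', c3'}"
    using g'
  proof (elim insertE emptyE)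
    assume "g = c2'"
    then show ?thesis using C'' dist'' by blast
  next
    assume "g = c3'"
    moreover have "{c, c3', c2'} \<in> P'" "distinct [a, b, c, a2, a3, b2, b3, c3', c2']"
      using C'' dist'' by (auto simp: insert_commute)
    ultimately show ?thesis by blast
  qed simp
  then obtain c2 c3 where C: "{c, c2, c3} \<in> P'" and dist: "distinct [a, b, c, a2, a3, b2, b3, c2, c3]"
    and c2: "c2 \<in> S" and D: "{c2, c3} = {c2', c3'}" using g(2) by blast
  have D_eq: "?D = {a2, a3, b2, b3, c2, c3}" using D by auto
  obtain y where y: "S = {a3, c2, y}" "distinct [a3, c2, y]"
  proof -
    obtain u v where uv: "S = {a3, u, v}" "distinct [a3, u, v]"
      using card_3_obtain[OF T(2)[OF S(1)] S(2)] by metis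
    then consider "u = c2" | "v = c2" using c2 dist by auto
    then show thesis
      using that[of u] that[of v] uv by cases (auto simp: insert_commute)
  qed
  have yD: "y \<notin> ?D"
  proof
    assume "y \<in> ?D"
    then have "?D \<inter> S = S" using y D_eq by auto
    then show False using ev[OF S(1)] T(2)[OF S(1)] by simp
  qed
  have "b3 \<notin> S" using yD y dist by auto
  then have TS: "T0 \<inter> S = {}" using T(4)[OF T0(1) S(1)] T0(2) by blast
  \<comment> \<open>\<open>R\<close> and \<open>S\<close> already hold \<open>a2\<close>,
    \<open>b2\<close>, \<open>a3\<close> and \<open>c2\<close>, so only \<open>c3\<close> is left as
    partner of \<open>b3\<close>.\<close>
  have c3: "c3 \<in> T0"
  proof -
    obtain h where h: "h \<in> ?D" "h \<in> T0" "h \<noteq> b3" using ex[OF T0] by auto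
    have "h \<noteq> b2" using TR x(1) h by auto
    then have "h = c3" using h D_eq TR TS x(1) y(1) by auto
    then show ?thesis using h by simp
  qed
  obtain z where z: "T0 = {b3, c3, z}" "distinct [b3, c3, z]"
  proof -
    obtain u v where uv: "T0 = {b3, u, v}" "distinct [b3, u, v]"
      using card_3_obtain[OF T(2)[OF T0(1)] T0(2)] by metis
    then consider "u = c3" | "v = c3" using c3 dist by auto
    then show thesis
      using that[of u] that[of v] uv by cases (auto simp: insert_commute)
  qed
  have zD: "z \<notin> ?D"
  proof
    assume "z \<in> ?D"
    then have "?D \<inter> T0 = T0" using z D_eq by auto
    then show False using ev[OF T0(1)] T(2)[OF T0(1)] by simp
  qed
  have dist12: "distinct [a, b, c, a2, a3, b2, b3, c2, c3, x, y, z]"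
    using dist xD yD zD D_eq RK' SK TK SR TR TS abc x y z by auto
  have rows: "{a, b, c} \<in> P" "{a2, b2, x} \<in> P" "{a3, c2, y} \<in> P" "{b3, c3, z} \<in> P"
    using abcP R(1) S(1) T0(1) x(1) y(1) z(1) by simp_all
  obtain Q where Q: "Q \<in> P'" "x \<in> Q"
    using T'(5) cycle_subset T(1)[OF rows(2)] by (metis insert_subset)
  have Qd: "e \<notin> Q" if "e \<in> {a, b, c, a2, a3, b2, b3, c2, c3}" for e
    using T'(4)[OF Q(1) A', of e] T'(4)[OF Q(1) B, of e] T'(4)[OF Q(1) C, of e] Q(2) dist12 that by auto
  \<comment> \<open>Now the partitions exchange roles: the columns of \<open>a\<close> and
    \<open>b\<close> cross three rows each. As \<open>Q\<close> avoids the first three columns,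
    parity against the first hexad forces \<open>y\<close> into \<open>Q\<close>, and against the
    second \<open>z\<close>.\<close>
  have "cocycle \<C> {b, c, b2, x, c2, y}"
    using crossing_triple(2)[OF tri, of a b c a2 b2 x a3 c2 y] rows T'(1)[OF A'] dist12 by auto
  then have "even (card ({b, c, b2, x, c2, y} \<inter> Q))"
    using T'(1)[OF Q(1)] by (simp add: cocycle_def)
  then obtain y' where "y' \<in> {b, c, b2, x, c2, y}" "y' \<in> Q" "y' \<noteq> x"
    using even_card_Int_obtain[OF _ _ Q(2)] by blast
  then have yQ: "y \<in> Q" using Qd by auto
  have "cocycle \<C> {a, c, a2, x, c3, z}"
    using crossing_triple(2)[OF tri, of b a c b2 a2 x b3 c3 z] rows T'(1)[OF B] dist12
    by (auto simp: insert_commute)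
  then have "even (card ({a, c, a2, x, c3, z} \<inter> Q))"
    using T'(1)[OF Q(1)] by (simp add: cocycle_def)
  then obtain z' where "z' \<in> {a, c, a2, x, c3, z}" "z' \<in> Q" "z' \<noteq> x"
    using even_card_Int_obtain[OF _ _ Q(2)] by blast
  then have zQ: "z \<in> Q" using Qd by auto
  have "Q = {x, y, z}"
    using card_subset_eq[of Q "{x, y, z}"] T'(2)[OF Q(1)] finite_cycle[OF T'(1)[OF Q(1)]]
      Q(2) yQ zQ dist12 by simp
  then have "swappable_array P P' a b c a2 a3 b2 b3 c2 c3 x y z"
    using dist12 rows A' B C Q(1) by (simp add: swappable_array_def)
  then show ?thesis by blast
qed

end

section \<open>Cycles recovered from dependent sets\<close>

text \<open>The dependent sets are those containing a nonempty cycle. A nonempty cycle inside the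
  image of a circuit \<open>K\<close> pulls back to a dependent subset of \<open>K\<close>, hence to
  all of \<open>K\<close>; so circuits go to cycles. Splitting off circuits gives all cycles by
  induction on size.\<close>

lemma cycle_image_if_dependent_iff:
  assumes "binary_cycle_space E \<C>" "binary_cycle_space F \<D>" and bij: "bij_betw \<beta> E F"
    and dep: "\<And>S. S \<subseteq> E \<Longrightarrow> (\<exists>T\<in>\<C>. T \<noteq> {} \<and> T \<subseteq> S) \<longleftrightarrow> (\<exists>T\<in>\<D>. T \<noteq> {} \<and> T \<subseteq> \<beta> ` S)"
    and "S \<in> \<C>"
  shows "\<beta> ` S \<in> \<D>"
proof -
  interpret C: binary_cycle_space E \<C> by fact
  interpret D: binary_cycle_space F \<D> by fact
  have inj: "inj_on \<beta> E" using bij by (simp add: bij_betw_def)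
  show ?thesis
    using \<open>S \<in> \<C>\<close>
  proof (induction "card S" arbitrary: S rule: less_induct)
    case less
    show ?case
    proof (cases "S = {}")
      case True
      then show ?thesis using D.empty_cycle by simp
    next
      case False
      let ?X = "{T \<in> \<C>. T \<noteq> {} \<and> T \<subseteq> S}"
      have "?X \<noteq> {}" using False less.prems by blast
      moreover have "finite ?X"
        using C.finite_cycle[OF less.prems] by (auto intro: finite_subset[of _ "Pow S"])
      ultimately have "\<exists>K\<in>?X. \<forall>T\<in>?X. T \<subseteq> K \<longrightarrow> K = T" by (intro finite_has_minimal)
      then obtain K where "K \<in> ?X" and min: "\<forall>T\<in>?X. T \<subseteq> K \<longrightarrow> K = T" by (rule bexE)
      then have K: "K \<in> \<C>" "K \<noteq> {}" "K \<subseteq> S" by simp_all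
      have minimal: "K = T" if "T \<in> \<C>" "T \<noteq> {}" "T \<subseteq> K" for T
        using min that K(3) by simp
      have KE: "K \<subseteq> E" "S \<subseteq> E" using K(1) C.cycle_subset less.prems by simp_all
      obtain T where T: "T \<in> \<D>" "T \<noteq> {}" "T \<subseteq> \<beta> ` K" using dep[OF KE(1)] K(1,2) by blast
      then obtain U where U: "U \<subseteq> K" "T = \<beta> ` U" by (auto simp: subset_image_iff)
      have "U \<subseteq> E" using U KE by blast
      moreover have "\<exists>T\<in>\<D>. T \<noteq> {} \<and> T \<subseteq> \<beta> ` U" using T(1,2) U(2) by auto
      ultimately have "\<exists>V\<in>\<C>. V \<noteq> {} \<and> V \<subseteq> U" by (simp only: dep)
      then obtain V where "V \<in> \<C>" "V \<noteq> {}" "V \<subseteq> U" by blast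
      then have "U = K" using minimal[of V] U(1) by blast
      then have 1: "\<beta> ` K \<in> \<D>" using T U by simp
      have "S - K = sym_diff S K" using K(3) by blast
      then have "S - K \<in> \<C>" using C.sym_diff_cycle[OF less.prems K(1)] by simp
      moreover have "card (S - K) < card S"
        using K(2,3) C.finite_cycle[OF less.prems] by (intro psubset_card_mono) auto
      ultimately have 2: "\<beta> ` (S - K) \<in> \<D>" using less.hyps by blast
      have "S = sym_diff (S - K) K" using K(3) by blast
      then have "\<beta> ` S = \<beta> ` sym_diff (S - K) K" by simp
      also have "\<dots> = sym_diff (\<beta> ` (S - K)) (\<beta> ` K)"
        using KE by (intro image_sym_diff[OF inj]) auto
      finally show ?thesis using D.sym_diff_cycle[OF 2 1] by simp
    qed
  qed
qed

lemma cycle_iso_if_dependent_iff: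
  assumes C: "binary_cycle_space E \<C>" and D: "binary_cycle_space F \<D>" and bij: "bij_betw \<beta> E F"
    and dep: "\<And>S. S \<subseteq> E \<Longrightarrow> (\<exists>T\<in>\<C>. T \<noteq> {} \<and> T \<subseteq> S) \<longleftrightarrow> (\<exists>T\<in>\<D>. T \<noteq> {} \<and> T \<subseteq> \<beta> ` S)"
  shows "cycle_iso E \<C> F \<D> \<beta>"
  unfolding cycle_iso_def
proof (intro conjI allI impI iffI)
  show "bij_betw \<beta> E F" by fact
  show "\<beta> ` S \<in> \<D>" if "S \<in> \<C>" for S
    using cycle_image_if_dependent_iff[OF C D bij dep that] .
  \<comment> \<open>The converse is the same lemma for the inverse bijection.\<close>
  let ?\<gamma> = "inv_into E \<beta>"
  have inv: "?\<gamma> ` \<beta> ` S = S" if "S \<subseteq> E" for S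
    using bij_betw_imp_inj_on[OF bij] that by (rule inv_into_image_cancel)
  have dep': "(\<exists>T\<in>\<D>. T \<noteq> {} \<and> T \<subseteq> S) \<longleftrightarrow> (\<exists>T\<in>\<C>. T \<noteq> {} \<and> T \<subseteq> ?\<gamma> ` S)" if "S \<subseteq> F" for S
  proof -
    have "S \<subseteq> \<beta> ` E" using that bij by (simp add: bij_betw_def)
    then obtain S' where S': "S' \<subseteq> E" "S = \<beta> ` S'" by (auto simp: subset_image_iff)
    show ?thesis
      unfolding S'(2) inv[OF S'(1)] using dep[OF S'(1)] by simp
  qed
  show "S \<in> \<C>" if "S \<subseteq> E" "\<beta> ` S \<in> \<D>" for S
    using cycle_image_if_dependent_iff[OF D C bij_betw_inv_into[OF bij] dep' that(2)] inv[OF that(1)]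
    by simp
qed

section \<open>Cycle spaces of column matroids over GF(2)\<close>

text \<open>The kernel of the matrix, with vectors over GF(2) identified with their
  supports.\<close>

definition column_cycles :: "'r set \<Rightarrow> 'e set \<Rightarrow> ('r \<Rightarrow> 'e \<Rightarrow> bit) \<Rightarrow> 'e set set" where
  "column_cycles R E A = {S. S \<subseteq> E \<and> (\<forall>u\<in>R. (\<Sum>w\<in>S. A u w) = 0)}"

lemma bit_add_self: "(a::bit) + a = 0"
  by (cases a) auto

lemma bit_add_left_self: "(a::bit) + (a + b) = b"
  by (cases a; cases b) auto

lemma sum_sym_diff_bit:
  fixes f :: "'e \<Rightarrow> bit"
  assumes "finite S" "finite T"
  shows "sum f (sym_diff S T) = sum f S + sum f T"
proof -
  have "sum f S = sum f (S - T) + sum f (S \<inter> T)"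
    using assms(1) by (subst sum.union_disjoint[symmetric]) (auto intro: sum.cong)
  moreover have "sum f T = sum f (T - S) + sum f (S \<inter> T)"
    using assms(2) by (subst sum.union_disjoint[symmetric]) (auto intro: sum.cong)
  moreover have "sum f (sym_diff S T) = sum f (S - T) + sum f (T - S)"
    using assms by (subst sum.union_disjoint[symmetric]) auto
  ultimately show ?thesis by (simp only: ac_simps bit_add_self bit_add_left_self add_0_left add_0_right)
qed

lemma binary_cycle_space_column_cycles:
  assumes "finite E"
  shows "binary_cycle_space E (column_cycles R E A)"
proof
  show "sym_diff S T \<in> column_cycles R E A"
    if "S \<in> column_cycles R E A" "T \<in> column_cycles R E A" for S T
  proof -
    have "finite S" "finite T" using that assms finite_subset by (auto simp: column_cycles_def)
    then show ?thesis using that by (auto simp: column_cycles_def sum_sym_diff_bit)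
  qed
qed (use assms in \<open>auto simp: column_cycles_def\<close>)

text \<open>Over GF(2) a coefficient vector is the characteristic function of its support, so a
  nontrivial relation is a nonempty zero-sum set.\<close>

lemma columns_dependent_bit_iff:
  fixes A :: "'r \<Rightarrow> 'e \<Rightarrow> bit"
  assumes "finite E" "S \<subseteq> E"
  shows "columns_dependent R A S \<longleftrightarrow> (\<exists>T\<in>column_cycles R E A. T \<noteq> {} \<and> T \<subseteq> S)"
proof
  have fin: "finite S" using assms finite_subset by blast
  assume "columns_dependent R A S"
  then obtain c where c: "\<exists>w\<in>S. c w \<noteq> 0" "\<forall>u\<in>R. (\<Sum>w\<in>S. c w * A u w) = 0"
    by (auto simp: columns_dependent_def)
  define T where "T = {w \<in> S. c w \<noteq> 0}"
  have "(\<Sum>w\<in>T. A u w) = (\<Sum>w\<in>S. c w * A u w)" for u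
  proof -
    have "(\<Sum>w\<in>T. A u w) = (\<Sum>w\<in>T. c w * A u w)"
      by (rule sum.cong) (auto simp: T_def)
    also have "\<dots> = (\<Sum>w\<in>S. c w * A u w)"
      using fin by (intro sum.mono_neutral_left) (auto simp: T_def)
    finally show ?thesis .
  qed
  then have "T \<in> column_cycles R E A" using c(2) assms(2) by (auto simp: column_cycles_def T_def)
  moreover have "T \<noteq> {}" "T \<subseteq> S" using c(1) by (auto simp: T_def)
  ultimately show "\<exists>T\<in>column_cycles R E A. T \<noteq> {} \<and> T \<subseteq> S" by blast
next
  have fin: "finite S" using assms finite_subset by blast
  assume "\<exists>T\<in>column_cycles R E A. T \<noteq> {} \<and> T \<subseteq> S"
  then obtain T where T: "T \<in> column_cycles R E A" "T \<noteq> {}" "T \<subseteq> S" by blast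
  let ?c = "\<lambda>w. if w \<in> T then 1 else (0::bit)"
  have "(\<Sum>w\<in>S. ?c w * A u w) = (\<Sum>w\<in>T. A u w)" for u
  proof -
    have "(\<Sum>w\<in>S. ?c w * A u w) = (\<Sum>w\<in>T. ?c w * A u w)"
      using fin T(3) by (intro sum.mono_neutral_right) auto
    also have "\<dots> = (\<Sum>w\<in>T. A u w)" by (rule sum.cong) auto
    finally show ?thesis .
  qed
  then have "\<forall>u\<in>R. (\<Sum>w\<in>S. ?c w * A u w) = 0" using T(1) by (simp add: column_cycles_def)
  moreover have "\<exists>w\<in>S. ?c w \<noteq> 0" using T(2,3) by auto
  ultimately show "columns_dependent R A S" unfolding columns_dependent_def by (intro exI[of _ ?c] conjI)
qed

text \<open>Independence is the absence of a nonempty cycle. From left to right cycles are recovered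
  from dependence; conversely, the nonempty cycles inside \<open>S\<close> correspond to those
  inside its image.\<close>

lemma matroid_isomorphism_column_matroid_iff:
  fixes A :: "'r \<Rightarrow> 'e \<Rightarrow> bit" and B :: "'s \<Rightarrow> 'f \<Rightarrow> bit"
  assumes "finite E" "finite F"
  shows "matroid_isomorphism (column_matroid R E A) (column_matroid Q F B) \<beta> \<longleftrightarrow>
    cycle_iso E (column_cycles R E A) F (column_cycles Q F B) \<beta>" (is "?L \<longleftrightarrow> ?R")
proof
  let ?dep = "\<lambda>S. (\<exists>T\<in>column_cycles R E A. T \<noteq> {} \<and> T \<subseteq> S) \<longleftrightarrow>
    (\<exists>T\<in>column_cycles Q F B. T \<noteq> {} \<and> T \<subseteq> \<beta> ` S)"
  have iff: "?dep S \<longleftrightarrow> (S \<in> indep_sets (column_matroid R E A) \<longleftrightarrow>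
      \<beta> ` S \<in> indep_sets (column_matroid Q F B))" if "S \<subseteq> E" "bij_betw \<beta> E F" for S
  proof -
    have "\<beta> ` S \<subseteq> F" using that by (auto simp: bij_betw_def)
    then show ?thesis
      using that assms columns_dependent_bit_iff[of E S R A]
        columns_dependent_bit_iff[of F "\<beta> ` S" Q B] by (auto simp: column_matroid_def)
  qed
  show ?R if ?L
  proof (rule cycle_iso_if_dependent_iff)
    show bij: "bij_betw \<beta> E F" using that by (simp add: matroid_isomorphism_def column_matroid_def)
    show "?dep S" if "S \<subseteq> E" for S
      using \<open>?L\<close> iff[OF that bij] that by (simp add: matroid_isomorphism_def column_matroid_def)
  qed (use assms in \<open>simp_all add: binary_cycle_space_column_cycles\<close>)
  show ?L if ?R
    unfolding matroid_isomorphism_def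
  proof (intro conjI allI impI)
    have bij: "bij_betw \<beta> E F" and cyc: "\<And>S. S \<subseteq> E \<Longrightarrow> S \<in> column_cycles R E A \<longleftrightarrow> \<beta> ` S \<in> column_cycles Q F B"
      using that by (auto simp: cycle_iso_def)
    then show "bij_betw \<beta> (ground (column_matroid R E A)) (ground (column_matroid Q F B))"
      by (simp add: column_matroid_def)
    fix S assume "S \<subseteq> ground (column_matroid R E A)"
    then have S: "S \<subseteq> E" by (simp add: column_matroid_def)
    have "?dep S"
    proof
      assume "\<exists>T\<in>column_cycles R E A. T \<noteq> {} \<and> T \<subseteq> S"
      then obtain T where T: "T \<in> column_cycles R E A" "T \<noteq> {}" "T \<subseteq> S" by blast
      then have "\<beta> ` T \<in> column_cycles Q F B" using cyc[of T] S by simp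
      then show "\<exists>T\<in>column_cycles Q F B. T \<noteq> {} \<and> T \<subseteq> \<beta> ` S"
        using T(2,3) by (intro bexI[of _ "\<beta> ` T"]) auto
    next
      assume "\<exists>T\<in>column_cycles Q F B. T \<noteq> {} \<and> T \<subseteq> \<beta> ` S"
      then obtain T where T: "T \<in> column_cycles Q F B" "T \<noteq> {}" "T \<subseteq> \<beta> ` S" by blast
      then obtain U where U: "U \<subseteq> S" "T = \<beta> ` U" by (auto simp: subset_image_iff)
      then have "U \<in> column_cycles R E A" using cyc[of U] S T(1) by simp
      then show "\<exists>T\<in>column_cycles R E A. T \<noteq> {} \<and> T \<subseteq> S"
        using T(2) U by (intro bexI[of _ U]) auto
    qed
    then show "S \<in> indep_sets (column_matroid R E A) \<longleftrightarrow> \<beta> ` S \<in> indep_sets (column_matroid Q F B)"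
      using iff[OF S bij] by simp
  qed
qed

section \<open>Equivalence of any two triangulations\<close>

context binary_cycle_space
begin

text \<open>Induction on the number of cells of \<open>P\<close> missing from \<open>P'\<close>.
  Once none is missing the partitions agree, because \<open>P\<close> already covers the ground
  set.\<close>

lemma triangulations_equivalent:
  assumes tri: "triangulation E \<C> P" and "triangulation E \<C> P'"
  shows "\<exists>\<sigma>. cycle_iso E \<C> E \<C> \<sigma> \<and> (`) \<sigma> ` P' = P"
  using assms(2)
proof (induction "card P - card (P \<inter> P')" arbitrary: P' rule: less_induct)
  case less
  note T = triangulationD[OF tri] and T' = triangulationD[OF less.prems]
  show ?case
  proof (cases "P \<subseteq> P'")
    case True
    have "K' \<in> P" if K': "K' \<in> P'" for K'
    proof -
      obtain e where e: "e \<in> K'" using T'(2)[OF K'] by force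
      then obtain K where "K \<in> P" "e \<in> K" using T(5) cycle_subset[OF T'(1)[OF K']] by blast
      then show ?thesis using T'(4)[OF K', of K e] e True by auto
    qed
    with True have "P' = P" by blast
    then have "cycle_iso E \<C> E \<C> id \<and> (`) id ` P' = P" by (simp add: cycle_iso_def)
    then show ?thesis by blast
  next
    case False
    then obtain K where K: "K \<in> P" "K \<notin> P'" by blast
    have "\<exists>\<sigma>. cycle_iso E \<C> E \<C> \<sigma> \<and> card (P \<inter> P') < card (P \<inter> (`) \<sigma> ` P')"
    proof (cases "\<exists>R\<in>P. \<exists>C\<in>P'. card (R \<inter> C) = 2")
      case True
      then show ?thesis using triangulation_step_parallel[OF tri less.prems] by blast
    next
      case False
      then have "\<And>R C. \<lbrakk>R \<in> P; C \<in> P'\<rbrakk> \<Longrightarrow> card (R \<inter> C) \<noteq> 2" by blast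
      from swappable_array_exists[OF tri less.prems this K] show ?thesis
        using triangulation_step_array[OF tri less.prems] by blast
    qed
    then obtain \<sigma> where \<sigma>: "cycle_iso E \<C> E \<C> \<sigma>" "card (P \<inter> P') < card (P \<inter> (`) \<sigma> ` P')"
      by blast
    have tri'': "triangulation E \<C> ((`) \<sigma> ` P')"
      using triangulation_image[OF \<sigma>(1) cycles_subset cycles_subset less.prems] .
    have "card (P \<inter> (`) \<sigma> ` P') \<le> card P" using T(3) by (intro card_mono) auto
    then have "card P - card (P \<inter> (`) \<sigma> ` P') < card P - card (P \<inter> P')" using \<sigma>(2) by simp
    then obtain \<tau> where \<tau>: "cycle_iso E \<C> E \<C> \<tau>" "(`) \<tau> ` (`) \<sigma> ` P' = P"
      using less.hyps[OF _ tri''] by blast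
    have "(`) (\<tau> \<circ> \<sigma>) ` P' = P"
      using \<tau>(2) by (simp add: image_image image_comp)
    then show ?thesis using cycle_iso_comp[OF \<sigma>(1) \<tau>(1)] by blast
  qed
qed

end

section \<open>The canonical partition as a triangulation\<close>

definition char_bit :: "'e set \<Rightarrow> 'e \<Rightarrow> bit" where
  "char_bit S w = (if w \<in> S then 1 else 0)"

lemma of_nat_card_bit_eq_0_iff: "(of_nat n :: bit) = 0 \<longleftrightarrow> even n"
  by (simp only: Z2.bit_eq_iff even_of_nat even_zero simp_thms)

lemma UNIV_symb: "(UNIV :: symb set) = {Phi, Chi, Psi}"
proof (rule UNIV_eq_I)
  show "s \<in> {Phi, Chi, Psi}" for s by (cases s) simp_all
qed

lemma sum_cells:
  fixes f :: "'v \<times> symb \<Rightarrow> bit"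
  assumes "finite V" "S \<subseteq> V \<times> UNIV"
  shows "sum f S = (\<Sum>v\<in>V. char_bit S (v, Phi) * f (v, Phi) + char_bit S (v, Chi) * f (v, Chi) +
    char_bit S (v, Psi) * f (v, Psi))"
proof -
  have "finite (V \<times> (UNIV :: symb set))" using assms(1) by (simp add: UNIV_symb)
  then have "sum f S = (\<Sum>w\<in>V \<times> UNIV. char_bit S w * f w)"
    using assms(2) by (intro sum.mono_neutral_cong_left) (auto simp: char_bit_def)
  also have "\<dots> = (\<Sum>v\<in>V. \<Sum>s\<in>UNIV. char_bit S (v, s) * f (v, s))"
    by (simp add: sum.cartesian_product case_prod_beta del: add_bit_eq_xor mult_bit_eq_and)
  also have "\<dots> = (\<Sum>v\<in>V. char_bit S (v, Phi) * f (v, Phi) + char_bit S (v, Chi) * f (v, Chi) +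
    char_bit S (v, Psi) * f (v, Psi))"
    by (simp add: UNIV_symb add.assoc del: add_bit_eq_xor mult_bit_eq_and)
  finally show ?thesis .
qed

text \<open>The identity enters the \<open>Phi\<close> and \<open>Psi\<close> columns, the adjacency
  matrix A the \<open>Chi\<close> and \<open>Psi\<close> columns. With r the sum of the
  \<open>Phi\<close> and \<open>Psi\<close> bits of \<open>S\<close> and t that of the
  \<open>Chi\<close> and \<open>Psi\<close> bits, \<open>S\<close> is a cycle iff r = A t.\<close>

lemma sum_IAS:
  assumes "finite (verts G)" "S \<subseteq> W G" "u \<in> verts G"
  shows "(\<Sum>w\<in>S. IAS G u w) = (char_bit S (u, Phi) + char_bit S (u, Psi)) +
    (\<Sum>v\<in>verts G. adjacency_matrix G u v * (char_bit S (v, Chi) + char_bit S (v, Psi)))"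
proof -
  have "(\<Sum>w\<in>S. IAS G u w) = (\<Sum>v\<in>verts G. char_bit S (v, Phi) * IAS G u (v, Phi) +
      char_bit S (v, Chi) * IAS G u (v, Chi) + char_bit S (v, Psi) * IAS G u (v, Psi))"
    using assms(1,2) by (intro sum_cells) (simp_all add: W_def)
  also have "\<dots> = (\<Sum>v\<in>verts G. (if u = v then char_bit S (v, Phi) + char_bit S (v, Psi) else 0) +
      adjacency_matrix G u v * (char_bit S (v, Chi) + char_bit S (v, Psi)))"
    by (intro sum.cong refl)
      (simp add: identity_matrix_def algebra_simps del: add_bit_eq_xor mult_bit_eq_and)
  also have "\<dots> = (char_bit S (u, Phi) + char_bit S (u, Psi)) +
    (\<Sum>v\<in>verts G. adjacency_matrix G u v * (char_bit S (v, Chi) + char_bit S (v, Psi)))"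
    using assms(1,3) by (simp add: sum.distrib sum.delta' del: add_bit_eq_xor mult_bit_eq_and)
  finally show ?thesis .
qed

text \<open>Intersection parity is the dot product of characteristic vectors, grouped by
  vertex.\<close>

lemma even_card_Int_iff:
  assumes "finite V" "S \<subseteq> V \<times> UNIV"
  shows "even (card (S \<inter> T)) \<longleftrightarrow> (\<Sum>v\<in>V. char_bit S (v, Phi) * char_bit T (v, Phi) +
    char_bit S (v, Chi) * char_bit T (v, Chi) + char_bit S (v, Psi) * char_bit T (v, Psi)) = 0"
proof -
  have "finite S" using assms(1,2) finite_subset[of S "V \<times> UNIV"] by (simp add: UNIV_symb)
  then have "(of_nat (card (S \<inter> T)) :: bit) = (\<Sum>w\<in>S. char_bit T w)"
    by (simp add: sum.If_cases char_bit_def del: add_bit_eq_xor mult_bit_eq_and)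
  then show ?thesis
    using of_nat_card_bit_eq_0_iff[of "card (S \<inter> T)"] sum_cells[OF assms, of "char_bit T"] by simp
qed

lemma partition_on_canonical: "partition_on (W G) (canonical_partition G)"
proof (rule partition_onI)
  show "\<Union> (canonical_partition G) = W G"
    by (auto simp: canonical_partition_def W_def UNIV_symb)
  show "disjnt p q" if "p \<in> canonical_partition G" "q \<in> canonical_partition G" "p \<noteq> q" for p q
    using that by (auto simp: canonical_partition_def disjnt_def)
  show "{} \<notin> canonical_partition G"
    by (auto simp: canonical_partition_def)
qed

lemma adjacency_matrix_commute: "adjacency_matrix G u v = adjacency_matrix G v u"
  by (simp add: adjacency_matrix_def insert_commute)

lemma bit_add_eq_0_iff: "(a::bit) + b = 0 \<longleftrightarrow> a = b"
  by (cases a; cases b) auto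

text \<open>Evenness on the cells makes the \<open>Psi\<close> bits of \<open>D\<close> the sum of
  its \<open>Phi\<close> bits p and \<open>Chi\<close> bits q, so the cycle equation becomes q = A
  p. For a cycle \<open>C\<close> it reads r = A t. The dot product of \<open>D\<close> and
  \<open>C\<close> is p.r + q.t = p.(A t) + (A p).t, which vanishes over GF(2) because A is
  symmetric.\<close>

lemma cocycle_if_even_on_canonical_cells:
  assumes fin: "finite (verts G)"
    and D: "D \<in> column_cycles (verts G) (W G) (IAS G)"
    and even: "\<And>v. v \<in> verts G \<Longrightarrow> even (card (D \<inter> {(v, Phi), (v, Chi), (v, Psi)}))"
  shows "cocycle (column_cycles (verts G) (W G) (IAS G)) D"
  unfolding cocycle_def
proof
  fix C assume C: "C \<in> column_cycles (verts G) (W G) (IAS G)"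
  let ?V = "verts G" and ?A = "adjacency_matrix G"
  define p q where "p = (\<lambda>v. char_bit D (v, Phi))" and "q = (\<lambda>v. char_bit D (v, Chi))"
  define r t where "r = (\<lambda>v. char_bit C (v, Phi) + char_bit C (v, Psi))" and "t = (\<lambda>v. char_bit C (v, Chi) + char_bit C (v, Psi))"
  have psi: "char_bit D (v, Psi) = p v + q v" if "v \<in> ?V" for v
    using even[OF that] even_card_Int_triple[of "(v, Phi)" "(v, Chi)" "(v, Psi)" D]
    by (auto simp: p_def q_def char_bit_def)
  have q: "q u = (\<Sum>v\<in>?V. ?A u v * p v)" if "u \<in> ?V" for u
  proof -
    have "0 = (\<Sum>w\<in>D. IAS G u w)" using D that by (simp add: column_cycles_def)
    also have "\<dots> = (p u + char_bit D (u, Psi)) + (\<Sum>v\<in>?V. ?A u v * (q v + char_bit D (v, Psi)))"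
      using D that fin unfolding p_def q_def by (intro sum_IAS) (auto simp: column_cycles_def)
    also have "\<dots> = q u + (\<Sum>v\<in>?V. ?A u v * p v)"
    proof -
      have "p u + char_bit D (u, Psi) = q u" using psi[OF that] by (simp only: bit_add_left_self)
      moreover have "q v + char_bit D (v, Psi) = p v" if "v \<in> ?V" for v
        by (simp only: psi[OF that] add.commute[of "p v"] bit_add_left_self)
      ultimately show ?thesis by simp
    qed
    finally show ?thesis using bit_add_eq_0_iff by metis
  qed
  have r: "r u = (\<Sum>v\<in>?V. ?A u v * t v)" if "u \<in> ?V" for u
  proof -
    have "0 = (\<Sum>w\<in>C. IAS G u w)" using C that by (simp add: column_cycles_def)
    also have "\<dots> = r u + (\<Sum>v\<in>?V. ?A u v * t v)"
      using C that fin unfolding r_def t_def by (intro sum_IAS) (auto simp: column_cycles_def)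
    finally show ?thesis using bit_add_eq_0_iff by metis
  qed
  have "(\<Sum>v\<in>?V. char_bit D (v, Phi) * char_bit C (v, Phi) + char_bit D (v, Chi) * char_bit C (v, Chi) +
      char_bit D (v, Psi) * char_bit C (v, Psi)) = (\<Sum>v\<in>?V. p v * r v + q v * t v)"
    by (intro sum.cong refl)
      (simp add: psi p_def q_def r_def t_def algebra_simps
        del: add_bit_eq_xor mult_bit_eq_and)
  also have "\<dots> = (\<Sum>u\<in>?V. p u * r u) + (\<Sum>v\<in>?V. q v * t v)"
    by (rule sum.distrib)
  also have "(\<Sum>u\<in>?V. p u * r u) = (\<Sum>u\<in>?V. \<Sum>v\<in>?V. p u * (?A u v * t v))"
    by (simp add: r sum_distrib_left del: add_bit_eq_xor mult_bit_eq_and)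
  also have "\<dots> = (\<Sum>v\<in>?V. \<Sum>u\<in>?V. p u * (?A u v * t v))"
    by (rule sum.swap)
  also have "\<dots> = (\<Sum>v\<in>?V. \<Sum>u\<in>?V. (?A v u * p u) * t v)"
    by (intro sum.cong refl, subst adjacency_matrix_commute, simp only: ac_simps)
  also have "\<dots> = (\<Sum>v\<in>?V. q v * t v)"
    by (simp add: q sum_distrib_right del: add_bit_eq_xor mult_bit_eq_and)
  finally have "(\<Sum>v\<in>?V. char_bit D (v, Phi) * char_bit C (v, Phi) + char_bit D (v, Chi) * char_bit C (v, Chi) +
      char_bit D (v, Psi) * char_bit C (v, Psi)) = 0"
    by (simp only: bit_add_self)
  then show "even (card (D \<inter> C))"
    using D fin by (subst even_card_Int_iff[of ?V]) (simp_all add: column_cycles_def W_def)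
qed

text \<open>Cells are cycles because each \<open>Psi\<close> column is the sum of the
  \<open>Phi\<close> and \<open>Chi\<close> columns of its vertex.\<close>

lemma triangulation_canonical:
  assumes "finite (verts G)"
  shows "triangulation (W G) (column_cycles (verts G) (W G) (IAS G)) (canonical_partition G)"
  unfolding triangulation_def
proof (intro conjI ballI impI)
  show "partition_on (W G) (canonical_partition G)" by (rule partition_on_canonical)
  show "canonical_partition G \<subseteq> column_cycles (verts G) (W G) (IAS G)"
  proof
    fix K assume "K \<in> canonical_partition G"
    then obtain v where v: "v \<in> verts G" "K = {(v, Phi), (v, Chi), (v, Psi)}"
      by (auto simp: canonical_partition_def)
    have "(\<Sum>w\<in>K. IAS G u w) = 0" for u
    proof -
      have "(\<Sum>w\<in>K. IAS G u w) = IAS G u (v, Phi) + (IAS G u (v, Chi) + IAS G u (v, Psi))"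
        by (simp add: v(2) del: add_bit_eq_xor mult_bit_eq_and)
      also have "\<dots> = 0"
        by (simp only: IAS.simps ac_simps bit_add_self bit_add_left_self)
      finally show ?thesis .
    qed
    then show "K \<in> column_cycles (verts G) (W G) (IAS G)"
      using v by (simp add: column_cycles_def W_def)
  qed
  show "card K = 3" if "K \<in> canonical_partition G" for K
    using that by (auto simp: canonical_partition_def)
  show "cocycle (column_cycles (verts G) (W G) (IAS G)) D"
    if "D \<in> column_cycles (verts G) (W G) (IAS G)"
      and "\<forall>K\<in>canonical_partition G. even (card (D \<inter> K))" for D
    using that by (intro cocycle_if_even_on_canonical_cells assms) (auto simp: canonical_partition_def)
qed

theorem theorem19:
  fixes G1 :: "'a lgraph" and G2 :: "'b lgraph"
  assumes "looped_simple_graph G1" and "looped_simple_graph G2"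
    and "\<exists>\<alpha>. matroid_isomorphism (M_IAS G1) (M_IAS G2) \<alpha>"
  shows "\<exists>\<beta>. matroid_isomorphism (M_IAS G1) (M_IAS G2) \<beta> \<and> compatible G1 G2 \<beta>"
proof -
  let ?C1 = "column_cycles (verts G1) (W G1) (IAS G1)"
    and ?C2 = "column_cycles (verts G2) (W G2) (IAS G2)"
  have fin: "finite (verts G1)" "finite (verts G2)"
    using assms(1,2) by (simp_all add: looped_simple_graph_def)
  then have finW: "finite (W G1)" "finite (W G2)" by (simp_all add: W_def UNIV_symb)
  have iso_iff: "matroid_isomorphism (M_IAS G1) (M_IAS G2) \<beta> \<longleftrightarrow> cycle_iso (W G1) ?C1 (W G2) ?C2 \<beta>" for \<beta>
    using matroid_isomorphism_column_matroid_iff[OF finW] by (simp add: M_IAS_def)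
  interpret binary_cycle_space "W G2" ?C2
    using binary_cycle_space_column_cycles[OF finW(2)] .
  obtain \<alpha> where \<alpha>: "cycle_iso (W G1) ?C1 (W G2) ?C2 \<alpha>" using assms(3) iso_iff by blast
  \<comment> \<open>The cells of \<open>G1\<close>, carried over by \<alpha>, and those of
    \<open>G2\<close> are two triangulations of one cycle space. An automorphism \<sigma> matches
    them, and composing it with \<alpha> makes the isomorphism compatible.\<close>
  have "triangulation (W G2) ?C2 ((`) \<alpha> ` canonical_partition G1)"
    using triangulation_image[OF \<alpha> _ cycles_subset triangulation_canonical[OF fin(1)]]
    by (auto simp: column_cycles_def)
  from triangulations_equivalent[OF triangulation_canonical[OF fin(2)] this]
  obtain \<sigma> where \<sigma>: "cycle_iso (W G2) ?C2 (W G2) ?C2 \<sigma>"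
    "(`) \<sigma> ` (`) \<alpha> ` canonical_partition G1 = canonical_partition G2"
    by (elim exE conjE)
  have "matroid_isomorphism (M_IAS G1) (M_IAS G2) (\<sigma> \<circ> \<alpha>)"
    using cycle_iso_comp[OF \<alpha> \<sigma>(1)] by (simp only: iso_iff)
  moreover have "compatible G1 G2 (\<sigma> \<circ> \<alpha>)"
    unfolding compatible_def \<sigma>(2)[symmetric] by (auto simp: image_comp)
  ultimately show ?thesis by blast
qed

end
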